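(* Consider the Lax-Friedrichs semi-discretization $\frac{d}{dt}\underline{q}=R(\underline{q})$ of the one-dimensional Euler equations, and an explicit $s$-stage Runge-Kutta method whose coefficients satisfy $0\le a_{ij},c_i,b_j\le 1$ for all $i,j$. Let $\underline{q}^n$ be a grid state with positive density and positive internal energy at every grid point. Then there exists $\Delta t^*>0$ such that for all $0<\Delta t\le \Delta t^*$ the density components of all stage solutions $\underline{q}^1,\dots,\underline{q}^s$ and of the step solution $\underline{q}^{RK}$ are positive at every grid point.
   Context: Euler variables: at each point $i$ of a finite grid (spacing $\Delta x>0$, indices understood periodically), $\underline{q}_i=(\rho_i,m_i,E_i)^T\in\mathbb{R}^3$ with density $\rho$, momentum $m=\rho u$, total energy $E$, internal energy $\rho e=E-\frac{m^2}{2\rho}$, pressure $p=(\gamma-1)\rho e$, where $\gamma>1$ is constant. The Euler flux is $f(\underline{q})=(m,\ \rho u^2+p,\ u(E+p))^T$. Lax-Friedrichs discretization: $R_i(\underline{q})=-\frac1{\Delta x}\big(h(\underline{q}_i,\underline{q}_{i+1})-h(\underline{q}_{i-1},\underline{q}_i)\big)$ with $h(\underline{q}_r,\underline{q}_k)=\frac12\big(f(\underline{q}_r)+f(\underline{q}_k)-a(\underline{q}_k-\underline{q}_r)\big)$ and $a=a(\underline{q})=\max_i\big(|u_i|+\sqrt{\gamma p_i/\rho_i}\big)$, the maximum being over all grid points of the state $\underline{q}$ at which $R$ is evaluated. $R$ is defined on grid states with positive density and internal energy at every point. An explicit $s$-stage Runge-Kutta method has real coefficients $a_{ij}$ ($1\le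 i,j\le s$, $a_{ij}=0$ for $j\ge i$), $b_j$, and $c_i=\sum_{j=1}^s a_{ij}$, with $\sum_{j=1}^s b_j=1$. Starting from $\underline{q}^n$ with step size $\Delta t$: $\underline{q}^i=\underline{q}^n+\Delta t\sum_{j=1}^s a_{ij}\underline{R}^j$, $\underline{R}^i=R(\underline{q}^i)$ for $i=1,\dots,s$, and $\underline{q}^{RK}=\underline{q}^n+\Delta t\sum_{j=1}^s b_j\underline{R}^j$. *)

theory Defs
  imports "HOL-Analysis.Analysis"
begin

(* A point state is the vector (density, momentum, total energy). *)
type_synonym euler_state = "real^3"

(* Grid points are the indices k < N; values at k >= N are never used. *)
type_synonym grid_state = "nat \<Rightarrow> euler_state"

definition mass_density :: "euler_state \<Rightarrow> real" where
  "mass_density q = q $ 1"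

definition momentum :: "euler_state \<Rightarrow> real" where
  "momentum q = q $ 2"

definition total_energy :: "euler_state \<Rightarrow> real" where
  "total_energy q = q $ 3"

definition velocity :: "euler_state \<Rightarrow> real" where
  "velocity q = momentum q / mass_density q"

(* Internal energy per unit volume, rho * e. *)
definition internal_energy :: "euler_state \<Rightarrow> real" where
  "internal_energy q = total_energy q - (momentum q)\<^sup>2 / (2 * mass_density q)"

definition pressure :: "real \<Rightarrow> euler_state \<Rightarrow> real" where
  "pressure \<gamma> q = (\<gamma> - 1) * internal_energy q"

definition euler_flux :: "real \<Rightarrow> euler_state \<Rightarrow> euler_state" where
  "euler_flux \<gamma> q = vector
     [momentum q,
      mass_density q * (velocity q)\<^sup>2 + pressure \<gamma> q,
      velocity q * (total_energy q + pressure \<gamma> q)]"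

definition max_wave_speed :: "real \<Rightarrow> nat \<Rightarrow> grid_state \<Rightarrow> real" where
  "max_wave_speed \<gamma> N q =
     Max ((\<lambda>k. \<bar>velocity (q k)\<bar> + sqrt (\<gamma> * pressure \<gamma> (q k) / mass_density (q k))) ` {..<N})"

definition lf_flux :: "real \<Rightarrow> real \<Rightarrow> euler_state \<Rightarrow> euler_state \<Rightarrow> euler_state" where
  "lf_flux \<gamma> a ql qr =
     (1/2) *\<^sub>R (euler_flux \<gamma> ql + euler_flux \<gamma> qr - a *\<^sub>R (qr - ql))"

(* The domain of the Lax-Friedrichs operator. *)
definition admissible :: "nat \<Rightarrow> grid_state \<Rightarrow> bool" where
  "admissible N q \<longleftrightarrow> (\<forall>k<N. mass_density (q k) > 0 \<and> internal_energy (q k) > 0)"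

(* Meaningful only for admissible q; outside that domain its values are
   artefacts of totality (x / 0 = 0, sqrt of negative numbers).
   The left neighbour of k is (k + N - 1) mod N because subtraction on nat truncates. *)
definition lf_rhs :: "real \<Rightarrow> real \<Rightarrow> nat \<Rightarrow> grid_state \<Rightarrow> grid_state" where
  "lf_rhs \<gamma> dx N q k =
     (let a = max_wave_speed \<gamma> N q in
      - (1 / dx) *\<^sub>R (lf_flux \<gamma> a (q k) (q ((k + 1) mod N))
                     - lf_flux \<gamma> a (q ((k + N - 1) mod N)) (q k)))"

(* Runge-Kutta coefficients A i j, b j are indexed by 1..s. *)
definition explicit_rk :: "nat \<Rightarrow> (nat \<Rightarrow> nat \<Rightarrow> real) \<Rightarrow> (nat \<Rightarrow> real) \<Rightarrow> bool" where
  "explicit_rk s A b \<longleftrightarrow>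
     (\<forall>i\<in>{1..s}. \<forall>j\<in>{1..s}. i \<le> j \<longrightarrow> A i j = 0) \<and> (\<Sum>j=1..s. b j) = 1"

definition rk_node :: "nat \<Rightarrow> (nat \<Rightarrow> nat \<Rightarrow> real) \<Rightarrow> nat \<Rightarrow> real" where
  "rk_node s A i = (\<Sum>j=1..s. A i j)"

(* For an explicit method only the summands with j < i occur; rk_stage_eq below
   gives the stage equation with the full sum over 1..s. *)
function rk_stage ::
    "(grid_state \<Rightarrow> grid_state) \<Rightarrow> (nat \<Rightarrow> nat \<Rightarrow> real) \<Rightarrow> real \<Rightarrow> grid_state \<Rightarrow> nat \<Rightarrow> grid_state" where
  "rk_stage R A dt q0 i =
     (\<lambda>k. q0 k + dt *\<^sub>R (\<Sum>j\<in>{1..<i}. A i j *\<^sub>R R (rk_stage R A dt q0 j) k))"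
  by pat_completeness auto
termination
  by (relation "Wellfounded.measure (\<lambda>(R, A, dt, q0, i). i)") auto

declare rk_stage.simps [simp del]

definition rk_step ::
    "(grid_state \<Rightarrow> grid_state) \<Rightarrow> nat \<Rightarrow> (nat \<Rightarrow> nat \<Rightarrow> real) \<Rightarrow> (nat \<Rightarrow> real) \<Rightarrow> real
      \<Rightarrow> grid_state \<Rightarrow> grid_state" where
  "rk_step R s A b dt q0 =
     (\<lambda>k. q0 k + dt *\<^sub>R (\<Sum>j=1..s. b j *\<^sub>R R (rk_stage R A dt q0 j) k))"

lemma rk_stage_eq:
  assumes "explicit_rk s A b" and "i \<in> {1..s}"
  shows "rk_stage R A dt q0 i k =
           q0 k + dt *\<^sub>R (\<Sum>j=1..s. A i j *\<^sub>R R (rk_stage R A dt q0 j) k)"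
proof -
  have "(\<Sum>j\<in>{1..<i}. A i j *\<^sub>R R (rk_stage R A dt q0 j) k) =
        (\<Sum>j=1..s. A i j *\<^sub>R R (rk_stage R A dt q0 j) k)"
    using assms by (intro sum.mono_neutral_left) (auto simp: explicit_rk_def)
  then show ?thesis
    by (subst rk_stage.simps) simp
qed

end

theory Submission
  imports Defs
begin

text \<open>
  The operator \<^const>\<open>lf_rhs\<close> is continuous at every admissible state, so all stages and the step
  converge to \<open>qn\<close> as \<open>dt\<close> tends to 0 from the right. Positivity is an open condition on finitely many
  grid points, hence holds for all stages once \<open>dt\<close> is small.
\<close>

text \<open>Induction reduces this to continuity of the binary \<open>max\<close>. It serves the
  wave speed, which couples all grid points through a maximum.\<close>

lemma tendsto_Max:
  fixes f :: "'i \<Rightarrow> 'a \<Rightarrow> 'b::linorder_topology"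
  assumes "finite I" "I \<noteq> {}" "\<And>i. i \<in> I \<Longrightarrow> ((\<lambda>x. f i x) \<longlongrightarrow> l i) F"
  shows "((\<lambda>x. Max ((\<lambda>i. f i x) ` I)) \<longlongrightarrow> Max (l ` I)) F"
  using assms by (induction I rule: finite_ne_induct) (auto intro: tendsto_max)

lemma tendsto_vector_3:
  fixes f g h :: "'a \<Rightarrow> real"
  assumes "(f \<longlongrightarrow> a) F" "(g \<longlongrightarrow> b) F" "(h \<longlongrightarrow> c) F"
  shows "((\<lambda>x. vector [f x, g x, h x] :: real^3) \<longlongrightarrow> vector [a, b, c]) F"
proof (rule vec_tendstoI)
  fix i :: 3
  show "((\<lambda>x. (vector [f x, g x, h x] :: real^3) $ i) \<longlongrightarrow> vector [a, b, c] $ i) F"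
    using exhaust_3[of i] assms by auto
qed

lemma
  fixes q :: "'a \<Rightarrow> euler_state"
  assumes "(q \<longlongrightarrow> q0) F"
  shows tendsto_mass_density: "((\<lambda>t. mass_density (q t)) \<longlongrightarrow> mass_density q0) F"
    and tendsto_momentum: "((\<lambda>t. momentum (q t)) \<longlongrightarrow> momentum q0) F"
    and tendsto_total_energy: "((\<lambda>t. total_energy (q t)) \<longlongrightarrow> total_energy q0) F"
  using assms by (auto simp: mass_density_def momentum_def total_energy_def intro: tendsto_vec_nth)

context
  fixes q :: "'a \<Rightarrow> euler_state" and q0 :: euler_state and F :: "'a filter"
  assumes lim: "(q \<longlongrightarrow> q0) F" and density_nz: "mass_density q0 \<noteq> 0"
begin

text \<open>Division by the density is the only possible source of discontinuity in the quantities
  of this context, hence the assumption on the limit \<open>q0\<close>.\<close>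

lemma tendsto_velocity: "((\<lambda>t. velocity (q t)) \<longlongrightarrow> velocity q0) F"
  unfolding velocity_def
  by (intro tendsto_divide tendsto_momentum tendsto_mass_density lim density_nz)

lemma tendsto_internal_energy: "((\<lambda>t. internal_energy (q t)) \<longlongrightarrow> internal_energy q0) F"
  unfolding internal_energy_def using density_nz
  by (intro tendsto_intros tendsto_total_energy tendsto_momentum tendsto_mass_density lim) auto

lemma tendsto_pressure: "((\<lambda>t. pressure \<gamma> (q t)) \<longlongrightarrow> pressure \<gamma> q0) F"
  unfolding pressure_def by (intro tendsto_intros tendsto_internal_energy)

lemma tendsto_euler_flux: "((\<lambda>t. euler_flux \<gamma> (q t)) \<longlongrightarrow> euler_flux \<gamma> q0) F"
  unfolding euler_flux_def
  by (intro tendsto_vector_3 tendsto_intros tendsto_total_energy tendsto_momentum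
      tendsto_mass_density tendsto_velocity tendsto_pressure lim)

end

text \<open>The viscosity coefficient varies along the filter as well, since it is computed from the
  whole grid state.\<close>

lemma tendsto_lf_flux:
  assumes "(a \<longlongrightarrow> a0) F" "(ql \<longlongrightarrow> ql0) F" "(qr \<longlongrightarrow> qr0) F"
    and "mass_density ql0 \<noteq> 0" "mass_density qr0 \<noteq> 0"
  shows "((\<lambda>t. lf_flux \<gamma> (a t) (ql t) (qr t)) \<longlongrightarrow> lf_flux \<gamma> a0 ql0 qr0) F"
  unfolding lf_flux_def by (intro tendsto_intros tendsto_euler_flux assms)

text \<open>The total function \<open>sqrt\<close> is odd and continuous on the whole real line, so
  the root stays harmless even where \<open>q t\<close> has negative pressure.\<close>

lemma tendsto_max_wave_speed:
  assumes "N \<ge> 1" "admissible N q0" "\<And>k. k < N \<Longrightarrow> ((\<lambda>t. q t k) \<longlongrightarrow> q0 k) F"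
  shows "((\<lambda>t. max_wave_speed \<gamma> N (q t)) \<longlongrightarrow> max_wave_speed \<gamma> N q0) F"
  unfolding max_wave_speed_def
proof (rule tendsto_Max)
  fix k assume "k \<in> {..<N}"
  then have "((\<lambda>t. q t k) \<longlongrightarrow> q0 k) F" "mass_density (q0 k) \<noteq> 0"
    using assms by (auto simp: admissible_def)
  then show "((\<lambda>t. \<bar>velocity (q t k)\<bar> + sqrt (\<gamma> * pressure \<gamma> (q t k) / mass_density (q t k))) \<longlongrightarrow>
      \<bar>velocity (q0 k)\<bar> + sqrt (\<gamma> * pressure \<gamma> (q0 k) / mass_density (q0 k))) F"
    by (intro tendsto_intros tendsto_velocity tendsto_pressure tendsto_mass_density)
qed (use assms(1) in \<open>auto simp: lessThan_empty_iff\<close>)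

text \<open>Admissibility is asked of the limit \<open>q0\<close> alone. Stages can therefore be
  shown to converge first and to be admissible afterwards, without interleaving the two
  arguments.\<close>

lemma tendsto_lf_rhs:
  assumes "N \<ge> 1" "admissible N q0" "\<And>k. k < N \<Longrightarrow> ((\<lambda>t. q t k) \<longlongrightarrow> q0 k) F" "k < N"
  shows "((\<lambda>t. lf_rhs \<gamma> dx N (q t) k) \<longlongrightarrow> lf_rhs \<gamma> dx N q0 k) F"
proof -
  \<comment> \<open>Convergence and admissibility are available only for indices below
    \<open>N\<close>, and the periodic neighbours stay in that range.\<close>
  have neighbours: "(k + 1) mod N < N" "(k + N - 1) mod N < N"
    using assms(1) by auto
  have density_nz: "mass_density (q0 l) \<noteq> 0" if "l < N" for l
    using that assms(2) by (auto simp: admissible_def)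
  show ?thesis
    unfolding lf_rhs_def Let_def
    by (intro tendsto_intros tendsto_lf_flux tendsto_max_wave_speed density_nz neighbours assms)
qed

lemma eventually_admissible:
  assumes "admissible N q0" "\<And>k. k < N \<Longrightarrow> ((\<lambda>t. q t k) \<longlongrightarrow> q0 k) F"
  shows "\<forall>\<^sub>F t in F. admissible N (q t)"
proof -
  have "\<forall>\<^sub>F t in F. mass_density (q t k) > 0 \<and> internal_energy (q t k) > 0" if "k \<in> {..<N}" for k
  proof (intro eventually_conj)
    have k: "((\<lambda>t. q t k) \<longlongrightarrow> q0 k) F" "mass_density (q0 k) > 0" "internal_energy (q0 k) > 0"
      using that assms by (auto simp: admissible_def)
    show "\<forall>\<^sub>F t in F. mass_density (q t k) > 0"
      by (rule order_tendstoD(1)[OF tendsto_mass_density[OF k(1)] k(2)])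
    show "\<forall>\<^sub>F t in F. internal_energy (q t k) > 0"
      by (rule order_tendstoD(1)[OF tendsto_internal_energy[OF k(1)] k(3)]) (use k(2) in simp)
  qed
  then have "\<forall>\<^sub>F t in F. \<forall>k\<in>{..<N}. mass_density (q t k) > 0 \<and> internal_energy (q t k) > 0"
    by (intro eventually_ball_finite ballI finite_lessThan)
  then show ?thesis
    by (simp add: admissible_def Ball_def)
qed

text \<open>Common form of a stage and of the step: the weighted sum converges, so the factor
  \<open>dt\<close> makes the increment vanish in the limit.\<close>

lemma tendsto_rk_increment:
  fixes g :: "'j \<Rightarrow> real \<Rightarrow> 'b::real_normed_vector"
  assumes "\<And>j. j \<in> J \<Longrightarrow> (g j \<longlongrightarrow> l j) (at_right 0)"
  shows "((\<lambda>dt. x + dt *\<^sub>R (\<Sum>j\<in>J. w j *\<^sub>R g j dt)) \<longlongrightarrow> x) (at_right 0)"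
proof -
  have "((\<lambda>dt. x + dt *\<^sub>R (\<Sum>j\<in>J. w j *\<^sub>R g j dt)) \<longlongrightarrow>
      x + 0 *\<^sub>R (\<Sum>j\<in>J. w j *\<^sub>R l j)) (at_right 0)"
    by (intro tendsto_intros assms)
  then show ?thesis
    by simp
qed

lemma tendsto_rk_stage:
  assumes "N \<ge> 1" "admissible N qn" "k < N"
  shows "((\<lambda>dt. rk_stage (lf_rhs \<gamma> dx N) A dt qn i k) \<longlongrightarrow> qn k) (at_right 0)"
  using assms(3)
\<comment> \<open>The point \<open>k\<close> is generalized because \<open>lf_rhs\<close> at one
  point depends on all grid points of the earlier stages through the wave speed.\<close>
proof (induction i arbitrary: k rule: less_induct)
  case (less i)
  have "((\<lambda>dt. lf_rhs \<gamma> dx N (rk_stage (lf_rhs \<gamma> dx N) A dt qn j) k) \<longlongrightarrow> lf_rhs \<gamma> dx N qn k)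
      (at_right 0)" if "j \<in> {1..<i}" for j
    using that assms(1,2) less by (intro tendsto_lf_rhs) auto
  from tendsto_rk_increment[where J = "{1..<i}", OF this] show ?case
    by (subst rk_stage.simps) simp
qed

lemma tendsto_rk_step:
  assumes "N \<ge> 1" "admissible N qn" "k < N"
  shows "((\<lambda>dt. rk_step (lf_rhs \<gamma> dx N) s A b dt qn k) \<longlongrightarrow> qn k) (at_right 0)"
  unfolding rk_step_def
  \<comment> \<open>All stages tend to \<open>qn\<close>, so their derivatives share one limit,
    independent of the stage index.\<close>
  by (rule tendsto_rk_increment[where l = "\<lambda>_. lf_rhs \<gamma> dx N qn k"])
    (intro tendsto_lf_rhs tendsto_rk_stage assms)

theorem theorem5:
  fixes \<gamma> dx :: real and N s :: nat
    and A :: "nat \<Rightarrow> nat \<Rightarrow> real" and b :: "nat \<Rightarrow> real"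
    and qn :: grid_state
  assumes "\<gamma> > 1" and "dx > 0" and "N \<ge> 1"
    and "explicit_rk s A b"
    and "\<forall>i\<in>{1..s}. \<forall>j\<in>{1..s}. 0 \<le> A i j \<and> A i j \<le> 1"
    and "\<forall>i\<in>{1..s}. 0 \<le> rk_node s A i \<and> rk_node s A i \<le> 1"
    and "\<forall>j\<in>{1..s}. 0 \<le> b j \<and> b j \<le> 1"
    and "\<forall>k<N. mass_density (qn k) > 0 \<and> internal_energy (qn k) > 0"
  shows "\<exists>dt_max>0. \<forall>dt. 0 < dt \<and> dt \<le> dt_max \<longrightarrow>
           (\<forall>i\<in>{1..s}. admissible N (rk_stage (lf_rhs \<gamma> dx N) A dt qn i)) \<and>
           (\<forall>i\<in>{1..s}. \<forall>k<N. mass_density (rk_stage (lf_rhs \<gamma> dx N) A dt qn i k) > 0) \<and>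
           (\<forall>k<N. mass_density (rk_step (lf_rhs \<gamma> dx N) s A b dt qn k) > 0)"
proof -
  have adm: "admissible N qn"
    using assms by (simp add: admissible_def)
  \<comment> \<open>Internal energy is controlled along with density, so that every evaluation of
    \<open>lf_rhs\<close> in the scheme takes place in its proper domain. A common range of
    \<open>dt\<close> exists because there are finitely many stages.\<close>
  have "\<forall>\<^sub>F dt in at_right 0. \<forall>i\<in>{1..s}. admissible N (rk_stage (lf_rhs \<gamma> dx N) A dt qn i)"
    by (intro eventually_ball_finite ballI eventually_admissible[OF adm] tendsto_rk_stage adm assms)
      auto
  moreover have "\<forall>\<^sub>F dt in at_right 0. admissible N (rk_step (lf_rhs \<gamma> dx N) s A b dt qn)"
    by (intro eventually_admissible[OF adm] tendsto_rk_step adm assms)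
  ultimately have "\<forall>\<^sub>F dt in at_right 0.
      (\<forall>i\<in>{1..s}. admissible N (rk_stage (lf_rhs \<gamma> dx N) A dt qn i)) \<and>
      admissible N (rk_step (lf_rhs \<gamma> dx N) s A b dt qn)"
    by (rule eventually_conj)
  then obtain d where d: "d > 0" "\<And>dt. 0 < dt \<Longrightarrow> dt < d \<Longrightarrow>
      (\<forall>i\<in>{1..s}. admissible N (rk_stage (lf_rhs \<gamma> dx N) A dt qn i)) \<and>
      admissible N (rk_step (lf_rhs \<gamma> dx N) s A b dt qn)"
    unfolding eventually_at_right_field by blast
  show ?thesis
  \<comment> \<open>Halving passes from the open range \<open>dt < d\<close> to a closed one, as the
    claim includes the endpoint.\<close>
  proof (intro exI[of _ "d / 2"] conjI[OF _ allI, OF _ impI])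
    fix dt assume "0 < dt \<and> dt \<le> d / 2"
    then have "0 < dt" "dt < d"
      using d(1) by auto
    from d(2)[OF this] show "(\<forall>i\<in>{1..s}. admissible N (rk_stage (lf_rhs \<gamma> dx N) A dt qn i)) \<and>
        (\<forall>i\<in>{1..s}. \<forall>k<N. mass_density (rk_stage (lf_rhs \<gamma> dx N) A dt qn i k) > 0) \<and>
        (\<forall>k<N. mass_density (rk_step (lf_rhs \<gamma> dx N) s A b dt qn k) > 0)"
      unfolding admissible_def by blast
  qed (use d(1) in simp)
qed

end
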